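(* If $q$ is a power of an odd prime, then \[ \triangle(q^6) \geq q^6 (q^3 - 1)(q + 1). \]
   Context: For a positive integer $k$, $\triangle(k)$ denotes the maximum number of triangles in a (finite, simple) 3-partite graph $G$ with $k$ vertices in each of its three parts such that, for any two of the three parts, the bipartite subgraph of $G$ formed by the edges between these two parts contains no cycle of length four. *)

theory Defs
  imports "Graph_Theory.Graph_Theory" "HOL-Computational_Algebra.Primes"
begin

text \<open>
  A finite simple graph is a \<^locale>\<open>pair_graph\<close>: a finite, symmetric, loop-free digraph
  whose arcs are ordered pairs, so that an edge between \<open>x\<close> and \<open>y\<close> is the pair of arcs
  \<open>(x, y)\<close>, \<open>(y, x)\<close>.

  A triangle is identified with its vertex set. In a simple graph a subgraph isomorphic to
  the complete graph on three vertices is induced, hence determined by that set.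
\<close>

definition triangles :: "'a pair_pre_digraph \<Rightarrow> 'a set set" where
  "triangles G = {T. T \<subseteq> pverts G \<and> complete_digraph 3 (with_proj G \<restriction> T)}"

text \<open>
  In a symmetric digraph, traversing one edge back and forth is a \<^const>\<open>pre_digraph.cycle\<close> of
  length 2. This does not affect length 4: the four vertices of such a cycle are distinct.
\<close>

definition has_four_cycle :: "('a, 'b) pre_digraph \<Rightarrow> bool" where
  "has_four_cycle H \<longleftrightarrow> (\<exists>p. pre_digraph.cycle H p \<and> length p = 4)"

definition is_independent :: "'a pair_pre_digraph \<Rightarrow> 'a set \<Rightarrow> bool" where
  "is_independent G X \<longleftrightarrow> (\<forall>x\<in>X. \<forall>y\<in>X. (x, y) \<notin> parcs G)"

definition tripartition :: "nat \<Rightarrow> 'a pair_pre_digraph \<Rightarrow> 'a set \<Rightarrow> 'a set \<Rightarrow> 'a set \<Rightarrow> bool" where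
  "tripartition k G X Y Z \<longleftrightarrow>
     X \<union> Y \<union> Z = pverts G \<and> X \<inter> Y = {} \<and> X \<inter> Z = {} \<and> Y \<inter> Z = {} \<and>
     card X = k \<and> card Y = k \<and> card Z = k \<and>
     is_independent G X \<and> is_independent G Y \<and> is_independent G Z"

text \<open>
  As the parts are independent sets, the bipartite graph between two of them is the subgraph
  induced on their union.
\<close>

definition admissible :: "nat \<Rightarrow> 'a pair_pre_digraph \<Rightarrow> bool" where
  "admissible k G \<longleftrightarrow> pair_graph G \<and>
     (\<exists>X Y Z. tripartition k G X Y Z \<and>
        \<not> has_four_cycle (with_proj G \<restriction> (X \<union> Y)) \<and>
        \<not> has_four_cycle (with_proj G \<restriction> (X \<union> Z)) \<and>
        \<not> has_four_cycle (with_proj G \<restriction> (Y \<union> Z)))"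

text \<open>
  The maximum ranges over graphs with vertices in \<^typ>\<open>nat\<close>; every finite graph is isomorphic
  to one of these, so the bound \<open>card_triangles_le_max_triangles\<close> holds for every vertex type,
  and by \<open>max_triangles_attained\<close> the maximum exists.
\<close>

definition max_triangles :: "nat \<Rightarrow> nat" (\<open>\<triangle>'(_')\<close>) where
  "\<triangle>(k) = Max {card (triangles G) | G :: nat pair_pre_digraph. admissible k G}"

lemma triangles_iff:
  assumes "pair_graph G"
  shows "T \<in> triangles G \<longleftrightarrow>
    T \<subseteq> pverts G \<and> card T = 3 \<and> (\<forall>x\<in>T. \<forall>y\<in>T. x \<noteq> y \<longrightarrow> (x, y) \<in> parcs G)"
proof -
  interpret pair_graph G by fact
  let ?H = "\<lparr>pverts = T, parcs = {(x, y) \<in> parcs G. x \<in> T \<and> y \<in> T}\<rparr>"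
  have H: "with_proj G \<restriction> T = with_proj ?H"
    by (auto simp: induce_subgraph_def with_proj_def)
  have nl: "x \<noteq> y" if "(x, y) \<in> parcs G" for x y
    using pair_no_loops[OF that] by simp
  show ?thesis
    unfolding triangles_def mem_Collect_eq H complete_digraph_pair_def
    using nl by (auto intro: card_ge_0_finite simp: set_eq_iff)
qed

lemma has_four_cycle_iff:
  assumes "pair_graph G"
  shows "has_four_cycle (with_proj G \<restriction> S) \<longleftrightarrow>
    (\<exists>a\<in>S. \<exists>b\<in>S. \<exists>c\<in>S. \<exists>d\<in>S. distinct [a, b, c, d] \<and>
       (a, b) \<in> parcs G \<and> (b, c) \<in> parcs G \<and> (c, d) \<in> parcs G \<and> (d, a) \<in> parcs G)"
    (is "?L \<longleftrightarrow> ?R")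
proof
  assume ?L
  then obtain p where p: "pre_digraph.cycle (with_proj G \<restriction> S) p" "length p = 4"
    by (auto simp: has_four_cycle_def)
  from p(2) obtain e1 e2 e3 e4 where p': "p = [e1, e2, e3, e4]"
    by (auto simp: numeral_eq_Suc length_Suc_conv)
  obtain a b c d a' b' c' d' where e: "e1 = (a, a')" "e2 = (b, b')" "e3 = (c, c')" "e4 = (d, d')"
    by (meson surj_pair)
  have "a' = b" "b' = c" "c' = d" "d' = a" "distinct [b, c, d, a]"
    "{a, b, c, d} \<subseteq> S"
    "(a, b) \<in> parcs G" "(b, c) \<in> parcs G" "(c, d) \<in> parcs G" "(d, a) \<in> parcs G"
    using p(1)[unfolded pre_digraph.cycle_def pre_digraph.awalk_def p' e]
    by (simp_all add: pre_digraph.awalk_verts.simps pre_digraph.cas.simps induce_subgraph_def)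
      blast+
  then show ?R
    by (intro bexI[of _ a] bexI[of _ b] bexI[of _ c] bexI[of _ d]) auto
next
  assume ?R
  then obtain a b c d where *: "a \<in> S" "b \<in> S" "c \<in> S" "d \<in> S" "distinct [a, b, c, d]"
    "(a, b) \<in> parcs G" "(b, c) \<in> parcs G" "(c, d) \<in> parcs G" "(d, a) \<in> parcs G"
    by blast
  then have "pre_digraph.cycle (with_proj G \<restriction> S) [(a, b), (b, c), (c, d), (d, a)]"
    by (auto simp: pre_digraph.cycle_def pre_digraph.awalk_def pre_digraph.awalk_verts.simps
         pre_digraph.cas.simps induce_subgraph_def)
  then show ?L
    unfolding has_four_cycle_def by (intro exI conjI) auto
qed

lemma finite_triangle_counts:
  "finite {card (triangles G) | G :: 'a pair_pre_digraph. admissible k G}"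
proof (rule finite_subset)
  show "{card (triangles G) | G :: 'a pair_pre_digraph. admissible k G} \<subseteq> {..2 ^ (3 * k)}"
  proof safe
    fix G :: "'a pair_pre_digraph"
    assume G: "admissible k G"
    then interpret pair_graph G by (simp add: admissible_def)
    from G obtain X Y Z where XYZ: "tripartition k G X Y Z" by (auto simp: admissible_def)
    have "card (pverts G) \<le> 3 * k"
      using XYZ card_Un_le[of "X \<union> Y" Z] card_Un_le[of X Y] by (auto simp: tripartition_def)
    moreover have "card (triangles G) \<le> card (Pow (pverts G))"
      by (rule card_mono) (auto simp: triangles_def)
    ultimately show "card (triangles G) \<le> 2 ^ (3 * k)"
      by (simp add: card_Pow) (meson le_trans one_le_numeral power_increasing)
  qed
qed simp

lemma ex_admissible: "\<exists>G :: nat pair_pre_digraph. admissible k G"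
proof -
  let ?G = "\<lparr>pverts = {..<3 * k}, parcs = {}\<rparr> :: nat pair_pre_digraph"
  have pg: "pair_graph ?G"
    by unfold_locales (auto simp: symmetric_def)
  have "tripartition k ?G {..<k} {k..<2 * k} {2 * k..<3 * k}"
    by (auto simp: tripartition_def is_independent_def)
  then show ?thesis
    unfolding admissible_def using pg by (intro exI[of _ ?G]) (auto simp: has_four_cycle_iff)
qed

lemma max_triangles_attained:
  "\<exists>G :: nat pair_pre_digraph. admissible k G \<and> card (triangles G) = \<triangle>(k)"
proof -
  have "\<triangle>(k) \<in> {card (triangles G) | G :: nat pair_pre_digraph. admissible k G}"
    unfolding max_triangles_def using finite_triangle_counts ex_admissible by (intro Max_in) auto
  then show ?thesis by force
qed

lemma card_triangles_le_max_triangles: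
  fixes G :: "'a pair_pre_digraph"
  assumes G: "admissible k G"
  shows "card (triangles G) \<le> \<triangle>(k)"
proof -
  from G interpret pair_graph G by (simp add: admissible_def)
  have pgG: "pair_graph G" by unfold_locales
  from G obtain X Y Z where tri: "tripartition k G X Y Z"
    and c4: "\<not> has_four_cycle (with_proj G \<restriction> (X \<union> Y))"
      "\<not> has_four_cycle (with_proj G \<restriction> (X \<union> Z))"
      "\<not> has_four_cycle (with_proj G \<restriction> (Y \<union> Z))"
    by (auto simp: admissible_def)
  obtain f :: "'a \<Rightarrow> nat" where inj: "inj_on f (pverts G)"
    using finite_imp_inj_to_nat_seg[OF pair_finite_verts] by blast
  let ?H = "\<lparr>pverts = f ` pverts G, parcs = map_prod f f ` parcs G\<rparr>"
  have inV: "x \<in> pverts G" "y \<in> pverts G" if "(x, y) \<in> parcs G" for x y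
    using that in_arcsD1 in_arcsD2 by auto
  have arc: "(f x, f y) \<in> parcs ?H \<longleftrightarrow> (x, y) \<in> parcs G"
    if xy: "x \<in> pverts G" "y \<in> pverts G" for x y
  proof
    assume "(f x, f y) \<in> parcs ?H"
    then obtain u v where uv: "(u, v) \<in> parcs G" "f u = f x" "f v = f y" by force
    have "u = x" "v = y"
      using inj_onD[OF inj uv(2) inV(1)[OF uv(1)] xy(1)]
        inj_onD[OF inj uv(3) inV(2)[OF uv(1)] xy(2)] .
    with uv(1) show "(x, y) \<in> parcs G" by simp
  qed force
  have sym: "(y, x) \<in> parcs G" if "(x, y) \<in> parcs G" for x y
    using that pair_sym_arcs by (auto simp: symmetric_def dest: symD)
  have arcE: thesis
    if "e \<in> parcs ?H" "\<And>x y. e = (f x, f y) \<Longrightarrow> (x, y) \<in> parcs G \<Longrightarrow> thesis" for e thesis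
    using that by auto
  have pgH: "pair_graph ?H"
  proof unfold_locales
    show "symmetric (with_proj ?H)"
      unfolding symmetric_def with_proj_simps
    proof (rule symI)
      fix u v assume "(u, v) \<in> parcs ?H"
      then obtain x y where "u = f x" "v = f y" "(x, y) \<in> parcs G" by (auto elim: arcE)
      then show "(v, u) \<in> parcs ?H" using arc inV sym by blast
    qed
  next
    fix e assume "e \<in> parcs ?H"
    then obtain x y where e: "e = (f x, f y)" "(x, y) \<in> parcs G" by (rule arcE)
    have "x \<noteq> y" using pair_no_loops[OF e(2)] by simp
    then show "fst e \<noteq> snd e"
      using inj_onD[OF inj _ inV(1)[OF e(2)] inV(2)[OF e(2)]] e(1) by auto
  next
    show "finite (pverts ?H)" "finite (parcs ?H)"
      using pair_finite_verts pair_finite_arcs by auto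
  next
    fix e assume "e \<in> parcs ?H"
    then obtain x y where e: "e = (f x, f y)" "(x, y) \<in> parcs G" by (rule arcE)
    from e(1) inV[OF e(2)] show "fst e \<in> pverts ?H" "snd e \<in> pverts ?H" by auto
  qed
  have sub: "X \<subseteq> pverts G" "Y \<subseteq> pverts G" "Z \<subseteq> pverts G"
    using tri by (auto simp: tripartition_def)
  have ind: "is_independent ?H (f ` A)" if "is_independent G A" "A \<subseteq> pverts G" for A
    unfolding is_independent_def
  proof (intro ballI, elim imageE, hypsubst)
    fix x y assume xy: "x \<in> A" "y \<in> A"
    with that(2) have "x \<in> pverts G" "y \<in> pverts G" by auto
    from arc[OF this] that(1) xy show "(f x, f y) \<notin> parcs ?H"
      by (auto simp: is_independent_def)
  qed
  have crd: "card (f ` A) = card A" if "A \<subseteq> pverts G" for A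
    using that inj by (meson card_image inj_on_subset)
  have disj: "f ` A \<inter> f ` B = {}" if "A \<subseteq> pverts G" "B \<subseteq> pverts G" "A \<inter> B = {}" for A B
    using that inj by (metis image_empty inj_on_image_Int)
  have triH: "tripartition k ?H (f ` X) (f ` Y) (f ` Z)"
    using tri sub unfolding tripartition_def
    by (simp add: ind crd disj flip: image_Un)
  have c4H: "\<not> has_four_cycle (with_proj ?H \<restriction> (f ` A \<union> f ` B))"
    if no: "\<not> has_four_cycle (with_proj G \<restriction> (A \<union> B))" and AB: "A \<union> B \<subseteq> pverts G" for A B
  proof
    assume "has_four_cycle (with_proj ?H \<restriction> (f ` A \<union> f ` B))"
    then have "has_four_cycle (with_proj ?H \<restriction> (f ` (A \<union> B)))"
      by (simp add: image_Un)
    then obtain a b c d where m: "a \<in> A \<union> B" "b \<in> A \<union> B" "c \<in> A \<union> B" "d \<in> A \<union> B"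
      and ds: "distinct [f a, f b, f c, f d]"
      and e: "(f a, f b) \<in> parcs ?H" "(f b, f c) \<in> parcs ?H"
        "(f c, f d) \<in> parcs ?H" "(f d, f a) \<in> parcs ?H"
      unfolding has_four_cycle_iff[OF pgH] bex_simps by blast
    from m AB have v: "a \<in> pverts G" "b \<in> pverts G" "c \<in> pverts G" "d \<in> pverts G" by auto
    have "(a, b) \<in> parcs G" "(b, c) \<in> parcs G" "(c, d) \<in> parcs G" "(d, a) \<in> parcs G"
      using e arc v by blast+
    moreover have "distinct [a, b, c, d]" using ds by auto
    ultimately show False using no m unfolding has_four_cycle_iff[OF pgG] by blast
  qed
  have admH: "admissible k ?H"
    unfolding admissible_def
    using pgH triH c4H[OF c4(1) Un_least[OF sub(1,2)]] c4H[OF c4(2) Un_least[OF sub(1,3)]]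
      c4H[OF c4(3) Un_least[OF sub(2,3)]]
    by (intro conjI exI)
  have "card (triangles G) = card ((`) f ` triangles G)"
  proof (rule card_image[symmetric], rule inj_onI)
    fix S T assume "S \<in> triangles G" "T \<in> triangles G" "f ` S = f ` T"
    then show "S = T"
      using inj inj_on_image_eq_iff[OF inj] by (auto simp: triangles_def)
  qed
  also have "\<dots> \<le> card (triangles ?H)"
  proof (rule card_mono)
    show "finite (triangles ?H)"
      by (rule finite_subset[of _ "Pow (pverts ?H)"]) (auto simp: triangles_def)
    show "(`) f ` triangles G \<subseteq> triangles ?H"
    proof safe
      fix T assume "T \<in> triangles G"
      then have T: "T \<subseteq> pverts G" "card T = 3"
        "\<And>x y. x \<in> T \<Longrightarrow> y \<in> T \<Longrightarrow> x \<noteq> y \<Longrightarrow> (x, y) \<in> parcs G"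
        unfolding triangles_iff[OF pgG] by blast+
      have "(u, v) \<in> parcs ?H" if "u \<in> f ` T" "v \<in> f ` T" "u \<noteq> v" for u v
      proof -
        from that obtain x y where xy: "x \<in> T" "y \<in> T" "u = f x" "v = f y" by blast
        with that(3) have "x \<noteq> y" by blast
        then show ?thesis unfolding xy using T(1) T(3) xy(1,2) arc by blast
      qed
      then show "f ` T \<in> triangles ?H"
        unfolding triangles_iff[OF pgH] using crd[OF T(1)] T(1,2) by auto
    qed
  qed
  also have "\<dots> \<le> \<triangle>(k)"
    unfolding max_triangles_def using admH by (intro Max_ge finite_triangle_counts) blast
  finally show ?thesis .
qed

end

theory Submission
  imports "HOL-Algebra.Algebraic_Closure" "HOL-Number_Theory.Residues" Defs
begin

text \<open>
  Let \<open>K\<close> be the field with \<open>q\<^sup>3\<close> elements and \<open>s x = x ^ q\<close>. All three parts are copies of \<open>K \<times> K\<close>,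
  and \<open>x\<close>, \<open>y\<close> in consecutive parts are adjacent iff \<open>x\<^sub>2 - y\<^sub>2 = c * F (x\<^sub>1 - y\<^sub>1)\<close>, where
  \<open>F x = x * s x\<close> and the constant \<open>c \<noteq> 0\<close> depends on the pair of parts. There is no 4-cycle because
  \<open>F\<close> is planar: two solutions of \<open>F (x + a) - F x = e\<close> differ by some \<open>d\<close> with \<open>d * s a = - a * s d\<close>,
  and taking norms to the subfield of order \<open>q\<close> gives \<open>N d * N a = - N d * N a\<close>, so \<open>d = 0\<close> or
  \<open>a = 0\<close> as \<open>q\<close> is odd.

  A vertex lies in as many triangles as there are pairs \<open>(a, b)\<close> with
  \<open>\<alpha> * F a + \<beta> * F b + \<gamma> * F (a + b) = 0\<close>. For \<open>b \<noteq> 0\<close> this is an equation of degree \<open>q + 1\<close> in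
  \<open>a / b\<close>, and the constants can be chosen such that it has \<open>q + 1\<close> roots in \<open>K\<close>, the image of the
  projective line of order \<open>q\<close> under a Moebius transformation of \<open>K\<close>.
\<close>

section \<open>Frobenius maps and finite fields\<close>

lemma (in cring) binomial:
  assumes x [simp]: "x \<in> carrier R" and y [simp]: "y \<in> carrier R"
  shows "(x \<oplus> y) [^] n = (\<Oplus>k\<in>{..n}. [(n choose k)] \<cdot> (x [^] k \<otimes> y [^] (n - k)))"
proof (induction n)
  case 0
  then show ?case by simp
next
  case (Suc n)
  \<comment> \<open>\<open>B\<close> keeps the coefficient \<open>n choose k\<close> but lets the
    total exponent \<open>m\<close> vary, so that multiplying the sum for \<open>n\<close> by
    \<open>y\<close> only turns \<open>B n\<close> into \<open>B (Suc n)\<close>.\<close>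
  define B where "B = (\<lambda>m k. [(n choose k)] \<cdot> (x [^] k \<otimes> y [^] (m - k)))"
  have B [simp]: "B m k \<in> carrier R" for m k by (simp add: B_def)
  define T where "T = (\<lambda>k. [(n choose k)] \<cdot> (x [^] Suc k \<otimes> y [^] (n - k)))"
  have T [simp]: "T k \<in> carrier R" for k by (simp add: T_def)
  have xs: "(\<Oplus>k\<in>{..n}. B n k) \<otimes> x = (\<Oplus>k\<in>{..n}. T k)"
    by (subst finsum_ldistr) (auto intro!: finsum_cong'
        simp: B_def T_def add_pow_ldistr m_assoc m_lcomm m_comm[of _ x] add_pow_rdistr)
  have "(\<Oplus>k\<in>{..n}. B n k) \<otimes> y = (\<Oplus>k\<in>{..n}. B (Suc n) k)"
    by (subst finsum_ldistr)
       (auto intro!: finsum_cong' simp: B_def add_pow_ldistr m_assoc Suc_diff_le)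
  also have "\<dots> = (\<Oplus>k\<in>{..Suc n}. B (Suc n) k)"
    by (subst finsum_Suc) (auto simp: B_def binomial_eq_0)
  also have "\<dots> = (\<Oplus>k\<in>{..n}. B (Suc n) (Suc k)) \<oplus> B (Suc n) 0"
    by (subst finsum_Suc2) auto
  finally have ys: "(\<Oplus>k\<in>{..n}. B n k) \<otimes> y = \<dots>" .
  have "(x \<oplus> y) [^] Suc n = (\<Oplus>k\<in>{..n}. B n k) \<otimes> x \<oplus> (\<Oplus>k\<in>{..n}. B n k) \<otimes> y"
    using Suc by (simp add: B_def r_distr)
  also have "\<dots> = ((\<Oplus>k\<in>{..n}. T k) \<oplus> (\<Oplus>k\<in>{..n}. B (Suc n) (Suc k))) \<oplus> B (Suc n) 0"
    unfolding xs ys by (simp add: a_assoc)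
  also have "(\<Oplus>k\<in>{..n}. T k) \<oplus> (\<Oplus>k\<in>{..n}. B (Suc n) (Suc k)) =
     (\<Oplus>k\<in>{..n}. [(Suc n choose Suc k)] \<cdot> (x [^] Suc k \<otimes> y [^] (n - k)))"
    by (subst finsum_addf [symmetric])
       (auto intro!: finsum_cong' simp: B_def T_def add.nat_pow_mult simp del: nat_pow_Suc)
  also have "\<dots> \<oplus> B (Suc n) 0 = (\<Oplus>k\<in>{..Suc n}. [(Suc n choose k)] \<cdot> (x [^] k \<otimes> y [^] (Suc n - k)))"
    by (subst finsum_Suc2) (auto simp: B_def)
  finally show ?case .
qed

lemma (in cring) add_pow_eq_zero_of_dvd:
  assumes "[p] \<cdot> \<one> = \<zero>" "p dvd m" "x \<in> carrier R"
  shows "[(m :: nat)] \<cdot> x = \<zero>"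
proof -
  obtain k where m: "m = k * p" by (metis assms(2) dvdE mult.commute)
  have "[p] \<cdot> x = ([p] \<cdot> \<one>) \<otimes> x" using assms(3) by (simp add: add_pow_ldistr)
  then have "[p] \<cdot> x = \<zero>" using assms by simp
  then have "[(p * k)] \<cdot> x = \<zero>" using assms(3) by (simp flip: add.nat_pow_pow)
  then show ?thesis by (simp add: m mult.commute)
qed

lemma (in cring) frobenius_add:
  fixes p :: nat
  assumes p: "prime p" and char: "[p] \<cdot> \<one> = \<zero>"
    and x [simp]: "x \<in> carrier R" and y [simp]: "y \<in> carrier R"
  shows "(x \<oplus> y) [^] p = x [^] p \<oplus> y [^] p"
proof -
  \<comment> \<open>With \<open>p = r + 2\<close> the two end terms can be split off, and the
    indices \<open>Suc k\<close> with \<open>k \<le> r\<close> are exactly those strictly between 0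
    and \<open>p\<close>, where \<open>p\<close> divides the binomial coefficient.\<close>
  obtain r where r: "p = Suc (Suc r)"
    using prime_ge_2_nat[OF p] by (metis add_2_eq_Suc le_Suc_ex)
  have "(\<Oplus>k\<in>{..r}. [(p choose Suc k)] \<cdot> (x [^] Suc k \<otimes> y [^] (p - Suc k))) = (\<Oplus>k\<in>{..r}. \<zero>)"
    by (rule finsum_cong')
       (auto intro!: add_pow_eq_zero_of_dvd[OF char] dvd_choose_prime
         simp: p[unfolded r] r simp del: binomial_Suc_Suc)
  then show ?thesis
    unfolding binomial[OF x y] r
    by (subst finsum_Suc, simp, subst finsum_Suc2)
      (auto simp: a_comm simp del: nat_pow_Suc binomial_Suc_Suc)
qed

lemma (in cring) frobenius_pow_add:
  fixes p :: nat
  assumes "prime p" "[p] \<cdot> \<one> = \<zero>" "x \<in> carrier R" "y \<in> carrier R"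
  shows "(x \<oplus> y) [^] (p ^ n) = x [^] (p ^ n) \<oplus> y [^] (p ^ n)"
  by (induction n) (use assms in \<open>simp_all add: frobenius_add mult.commute[of p] flip: nat_pow_pow\<close>)

lemma (in cring) frobenius_pow_hom:
  fixes p :: nat
  assumes "prime p" "[p] \<cdot> \<one> = \<zero>"
  shows "(\<lambda>x. x [^] (p ^ n)) \<in> ring_hom R R"
  using assms by (auto intro!: ring_hom_memI simp: frobenius_pow_add nat_pow_distrib)


lemma (in field) fixed_points_subfield:
  assumes h: "h \<in> ring_hom R R"
  shows "subfield {x \<in> carrier R. h x = x} R"
proof -
  interpret h: ring_hom_cring R R h
    using h by unfold_locales
  show ?thesis
  proof (rule subfieldI')
    show "subring {x \<in> carrier R. h x = x} R"
      by (rule subringI) auto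
    fix k assume k: "k \<in> {x \<in> carrier R. h x = x} - {\<zero>}"
    then have u: "k \<in> Units R" by (simp add: field_Units)
    have "h (inv k) \<otimes> k = h (inv k \<otimes> k)"
      using k u by (simp del: Units_l_inv)
    also have "\<dots> = \<one>" using u by (simp add: Units_l_inv)
    finally have "h (inv k) = inv k"
      using k u by (metis (no_types, lifting) DiffD1 Units_inv_closed comm_inv_char h.hom_closed
          m_comm mem_Collect_eq)
    then show "inv k \<in> {x \<in> carrier R. h x = x}" using u by simp
  qed
qed

text \<open>This carries the characteristic over to polynomials, so that Frobenius is additive on
  them as well.\<close>

lemma (in domain) add_pow_one_poly_ring:
  assumes "[(p :: nat)] \<cdot> \<one> = \<zero>"
  shows "[p] \<cdot>\<^bsub>poly_ring R\<^esub> \<one>\<^bsub>poly_ring R\<^esub> = \<zero>\<^bsub>poly_ring R\<^esub>"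
proof -
  interpret UP: domain "poly_ring R"
    using univ_poly_is_domain[OF carrier_is_subring] .
  interpret c: ring_hom_ring R "poly_ring R" poly_of_const
    using canonical_embedding_ring_hom[OF carrier_is_subring] by simp
  have "poly_of_const ([(n :: nat)] \<cdot> \<one>) = [n] \<cdot>\<^bsub>poly_ring R\<^esub> \<one>\<^bsub>poly_ring R\<^esub>" for n
    by (induction n) simp_all
  from this[of p] assms show ?thesis by simp
qed

text \<open>The fixed points are the roots of X^Q - X with Q = p^n. This polynomial splits, so its
  multiset of roots has size Q, and no root is repeated.\<close>

lemma (in algebraically_closed) card_frobenius_fixed_points:
  fixes p :: nat
  assumes p: "prime p" and char: "[p] \<cdot> \<one> = \<zero>" and n: "n \<ge> 1"
  shows "card {x \<in> carrier L. x [^] (p ^ n) = x} = p ^ n"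
proof -
  define Q where "Q = p ^ n"
  have Q: "Q \<ge> 2"
    unfolding Q_def using one_less_power[OF prime_gt_1_nat[OF p], of n] n by simp
  let ?UP = "poly_ring L"
  interpret UP: domain ?UP
    using univ_poly_is_domain[OF carrier_is_subring] .
  have X [simp]: "X \<in> carrier ?UP" by (rule var_closed(1)[OF carrier_is_subring])
  define P where "P = X [^]\<^bsub>?UP\<^esub> Q \<ominus>\<^bsub>?UP\<^esub> X"
  have P [simp]: "P \<in> carrier ?UP" by (simp add: P_def)
  have eval_P: "eval P x = x [^] Q \<ominus> x" if "x \<in> carrier L" for x
  proof -
    interpret e: ring_hom_cring ?UP L "\<lambda>p. eval p x"
      by (rule eval_cring_hom[OF carrier_is_subring that])
    show ?thesis using eval_var[OF that] by (simp add: P_def a_minus_def UP.minus_eq)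
  qed
  have deg: "degree P = Q"
  proof -
    have "degree (X [^]\<^bsub>?UP\<^esub> Q) = Q"
      unfolding unitary_monom_eq_var_pow[OF carrier_is_subring, symmetric] by (simp add: monom_def)
    moreover have "degree (\<ominus>\<^bsub>?UP\<^esub> X) = 1"
      using univ_poly_a_inv_degree[OF carrier_is_subring X] by (simp add: var_def)
    ultimately show ?thesis
      unfolding P_def UP.minus_eq univ_poly_add
      using Q by (subst poly_add_degree_eq[OF carrier_is_subring]) (auto simp: univ_poly_carrier)
  qed
  have P_nz: "P \<noteq> []" using deg Q by auto
  \<comment> \<open>In terms of \<open>Y = X - a\<close> the polynomial \<open>X ^ Q - X\<close> is \<open>Y ^ Q - Y\<close>, which \<open>Y\<^sup>2\<close> does not divide.\<close>
  have simple: "alg_mult P a \<le> 1" if a: "a \<in> carrier L" for a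
  proof (rule ccontr)
    assume "\<not> alg_mult P a \<le> 1"
    then have ge2: "2 \<le> alg_mult P a" by simp
    define Y where "Y = [\<one>, \<ominus> a]"
    define c where "c = poly_of_const a"
    interpret c: ring_hom_ring L ?UP poly_of_const
      using canonical_embedding_ring_hom[OF carrier_is_subring] by simp
    interpret e: ring_hom_cring ?UP L "\<lambda>p. eval p a"
      by (rule eval_cring_hom[OF carrier_is_subring a])
    have c [simp]: "c \<in> carrier ?UP" using a by (simp add: c_def)
    have Y [simp]: "Y \<in> carrier ?UP"
      using a unfolding Y_def by (simp flip: univ_poly_carrier add: polynomial_def)
    have Y_nz: "Y \<noteq> \<zero>\<^bsub>?UP\<^esub>" by (simp add: Y_def univ_poly_zero)
    have eval_Y: "eval Y a = \<zero>" using a by (simp add: Y_def r_neg)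
    have "is_root P a"
      using ge2 alg_mult_gt_zero_iff_is_root[OF P, of a] by simp
    then have "a [^] Q \<ominus> a = \<zero>" using eval_P[OF a] by (simp add: is_root_def)
    then have aQ: "a [^] Q = a" using a by simp
    have "c [^]\<^bsub>?UP\<^esub> Q = poly_of_const (a [^] Q)"
      unfolding c_def using a by (induction Q) simp_all
    then have cQ: "c [^]\<^bsub>?UP\<^esub> Q = c" by (simp add: aQ c_def)
    have XY: "X = Y \<oplus>\<^bsub>?UP\<^esub> c"
      using a unfolding univ_poly_add Y_def c_def var_def poly_of_const_def by (simp add: l_neg)
    have "P = Y [^]\<^bsub>?UP\<^esub> Q \<ominus>\<^bsub>?UP\<^esub> Y"
      unfolding P_def XY unfolding Q_def
      unfolding UP.frobenius_pow_add[OF p add_pow_one_poly_ring[OF char] Y c]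
      unfolding Q_def[symmetric] cQ using Y c UP.nat_pow_closed[OF Y] by algebra
    \<comment> \<open>Since Q is at least 2, the cofactor of \<open>Y\<close> is
      \<open>Y ^ m * Y - 1\<close>. The extra factor \<open>Y\<close> makes it take the value -1 at
      \<open>a\<close> even if \<open>m = 0\<close>.\<close>
    also obtain m where m: "Q = Suc (Suc m)" using Q by (metis add_2_eq_Suc le_Suc_ex)
    have "Y [^]\<^bsub>?UP\<^esub> Q \<ominus>\<^bsub>?UP\<^esub> Y = Y \<otimes>\<^bsub>?UP\<^esub> (Y [^]\<^bsub>?UP\<^esub> m \<otimes>\<^bsub>?UP\<^esub> Y \<ominus>\<^bsub>?UP\<^esub> \<one>\<^bsub>?UP\<^esub>)"
      unfolding m UP.nat_pow_Suc using Y UP.nat_pow_closed[OF Y, of m] by algebra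
    finally have P1: "P = Y \<otimes>\<^bsub>?UP\<^esub> (Y [^]\<^bsub>?UP\<^esub> m \<otimes>\<^bsub>?UP\<^esub> Y \<ominus>\<^bsub>?UP\<^esub> \<one>\<^bsub>?UP\<^esub>)" .
    have "(Y [^]\<^bsub>?UP\<^esub> (2::nat)) pdivides P"
      unfolding Y_def by (rule le_alg_mult_imp_pdivides[OF a P ge2])
    then obtain r where r: "r \<in> carrier ?UP" "P = Y [^]\<^bsub>?UP\<^esub> (2::nat) \<otimes>\<^bsub>?UP\<^esub> r"
      unfolding pdivides_def factor_def by blast
    have "Y [^]\<^bsub>?UP\<^esub> (2::nat) = Y \<otimes>\<^bsub>?UP\<^esub> Y" by (simp add: numeral_2_eq_2)
    then have "Y \<otimes>\<^bsub>?UP\<^esub> (Y [^]\<^bsub>?UP\<^esub> m \<otimes>\<^bsub>?UP\<^esub> Y \<ominus>\<^bsub>?UP\<^esub> \<one>\<^bsub>?UP\<^esub>) = Y \<otimes>\<^bsub>?UP\<^esub> (Y \<otimes>\<^bsub>?UP\<^esub> r)"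
      using P1 r by (simp add: UP.m_assoc)
    then have eq: "Y [^]\<^bsub>?UP\<^esub> m \<otimes>\<^bsub>?UP\<^esub> Y \<ominus>\<^bsub>?UP\<^esub> \<one>\<^bsub>?UP\<^esub> = Y \<otimes>\<^bsub>?UP\<^esub> r"
      using UP.m_lcancel[of Y] r(1) Y_nz by (simp add: UP.minus_eq)
    have "eval (Y [^]\<^bsub>?UP\<^esub> m \<otimes>\<^bsub>?UP\<^esub> Y \<ominus>\<^bsub>?UP\<^esub> \<one>\<^bsub>?UP\<^esub>) a = \<ominus> \<one>"
      by (simp add: UP.minus_eq eval_Y)
    moreover have "eval (Y \<otimes>\<^bsub>?UP\<^esub> r) a = \<zero>"
      using r(1) by (simp add: eval_Y)
    ultimately have "\<ominus> \<one> = \<zero>" unfolding eq by simp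
    then show False by (metis add.inv_solve_left' minus_zero minus_minus one_closed one_not_zero)
  qed
  have cnt: "count (roots P) a \<le> 1" for a
  proof (cases "a \<in> carrier L")
    case True
    then show ?thesis using simple alg_mult_eq_count_roots[OF P] by metis
  next
    case False
    then show ?thesis
      using roots_mem_iff_is_root[OF P, of a] count_eq_zero_iff[of "roots P" a]
      by (simp add: is_root_def)
  qed
  have S: "set_mset (roots P) = {x \<in> carrier L. x [^] Q = x}"
  proof -
    have "x \<in># roots P \<longleftrightarrow> x \<in> carrier L \<and> x [^] Q = x" for x
      unfolding roots_mem_iff_is_root[OF P] is_root_def
      using P_nz eval_P r_right_minus_eq[of "x [^] Q" x] by (metis nat_pow_closed)
    then show ?thesis by blast
  qed
  have "Q = size (roots P)"
    using roots_over_carrier[OF P] deg by (simp add: splitted_def)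
  also have "\<dots> = (\<Sum>x\<in>set_mset (roots P). count (roots P) x)"
    by (rule size_multiset_overloaded_eq)
  also have "\<dots> = (\<Sum>x\<in>set_mset (roots P). 1)"
    by (intro sum.cong refl antisym cnt) (simp add: Suc_leI)
  finally show ?thesis unfolding S Q_def by simp
qed

text \<open>\<open>L\<close> is an algebraic closure of the prime field; its element type is that of
  the indexed polynomials over \<open>int\<close> among which the closure is built.\<close>

lemma exists_algebraically_closed_field:
  fixes p :: nat
  assumes p: "prime p"
  obtains L :: "((int list \<times> nat) multiset \<Rightarrow> int) ring"
  where "algebraically_closed L" "[p] \<cdot>\<^bsub>L\<^esub> \<one>\<^bsub>L\<^esub> = \<zero>\<^bsub>L\<^esub>"
proof -
  let ?R = "residue_ring (int p)"
  interpret R: residues_prime p ?R using p by unfold_locales auto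
  obtain L :: "((int list \<times> nat) multiset \<Rightarrow> int) ring"
    where L: "algebraic_closure L (R.indexed_const ` carrier ?R)" "R.indexed_const \<in> ring_hom ?R L"
    using R.exists_closure by blast
  interpret L: algebraic_closure L "R.indexed_const ` carrier ?R" by fact
  interpret h: ring_hom_cring ?R L R.indexed_const
    using L(2) by unfold_locales
  have "R.indexed_const ([(k::nat)] \<cdot>\<^bsub>?R\<^esub> \<one>\<^bsub>?R\<^esub>) = [k] \<cdot>\<^bsub>L\<^esub> \<one>\<^bsub>L\<^esub>" for k
    by (induction k) simp_all
  moreover have "[k] \<cdot>\<^bsub>?R\<^esub> \<one>\<^bsub>?R\<^esub> = int k mod int p" for k :: nat
    by (induction k) (auto simp: R.res_zero_eq R.res_one_eq R.res_add_eq mod_simps add_ac)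
  ultimately have "[p] \<cdot>\<^bsub>L\<^esub> \<one>\<^bsub>L\<^esub> = R.indexed_const \<zero>\<^bsub>?R\<^esub>"
    by (metis R.res_zero_eq mod_self)
  then show ?thesis using that[OF L.algebraically_closed_axioms] by simp
qed

section \<open>A graph from three rectangle-free relations\<close>

text \<open>A rectangle with \<open>x \<noteq> x'\<close> and \<open>y \<noteq> y'\<close> is a
  4-cycle between two disjoint copies of \<open>V\<close>. The two arguments of \<open>A\<close>
  belong to different copies, so \<open>A\<close> may be asymmetric.\<close>

definition rectangle_free :: "'a set \<Rightarrow> ('a \<Rightarrow> 'a \<Rightarrow> bool) \<Rightarrow> bool" where
  "rectangle_free V A \<longleftrightarrow> (\<forall>x\<in>V. \<forall>x'\<in>V. \<forall>y\<in>V. \<forall>y'\<in>V.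
     A x y \<and> A x y' \<and> A x' y \<and> A x' y' \<longrightarrow> x = x' \<or> y = y')"

lemma rectangle_freeD:
  assumes "rectangle_free V A" "x \<in> V" "x' \<in> V" "y \<in> V" "y' \<in> V"
    and "A x y" "A x y'" "A x' y" "A x' y'"
  shows "x = x' \<or> y = y'"
  using assms unfolding rectangle_free_def by simp

text \<open>Part \<open>i\<close> of the graph is \<open>{i} \<times> V\<close>, and \<open>A i\<close> joins part \<open>i\<close> to part \<open>(i + 1) mod 3\<close>.\<close>

lemma card_cyclic_triples_le_max_triangles:
  fixes V :: "'a set" and A :: "nat \<Rightarrow> 'a \<Rightarrow> 'a \<Rightarrow> bool"
  assumes V: "finite V" and free: "\<And>i. i < 3 \<Longrightarrow> rectangle_free V (A i)"
  shows "card {(x, y, z). x \<in> V \<and> y \<in> V \<and> z \<in> V \<and> A 0 x y \<and> A 1 y z \<and> A 2 z x} \<le> \<triangle>(card V)"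
proof -
  define part where "part = (\<lambda>i::nat. {i} \<times> V)"
  define E where "E = {((i, x), (j, y)) |i j x y. i < 3 \<and> j = (i + 1) mod 3 \<and> x \<in> V \<and> y \<in> V \<and> A i x y}"
  define G where "G = \<lparr>pverts = {..<3} \<times> V, parcs = E \<union> E\<inverse>\<rparr>"
  have Esub: "E \<subseteq> ({..<3} \<times> V) \<times> ({..<3} \<times> V)" by (auto simp: E_def)
  have E_fst: "fst v = (fst u + 1) mod 3 \<and> fst u < 3 \<and> A (fst u) (snd u) (snd v)" if "(u, v) \<in> E" for u v
    using that by (auto simp: E_def)
  have E_neq: "fst u \<noteq> fst v" if "(u, v) \<in> E" for u v
    using E_fst[OF that] by presburger
  have pg: "pair_graph G"
  proof unfold_locales
    show "symmetric (with_proj G)"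
      by (auto simp: symmetric_def G_def sym_def)
    show "finite (parcs G)"
      using finite_subset[OF Esub] V by (simp add: G_def)
    fix e assume e: "e \<in> parcs G"
    show "fst e \<noteq> snd e" using e E_neq[of "fst e" "snd e"] E_neq[of "snd e" "fst e"]
      by (auto simp: G_def converse_def)
    show "fst e \<in> pverts G" "snd e \<in> pverts G" using e Esub by (auto simp: G_def)
  qed (use V in \<open>simp add: G_def\<close>)
  have no_c4: "\<not> has_four_cycle (with_proj G \<restriction> (part i \<union> part j))"
    if i: "i < 3" and j: "j = (i + 1) mod 3" for i j
  proof
    \<comment> \<open>The successor of \<open>j\<close> is the third index. Hence every arc between
      parts \<open>i\<close> and \<open>j\<close> comes from \<open>A i\<close>, never from
      \<open>A j\<close>.\<close>
    have ij: "i \<noteq> j" "i \<noteq> (j + 1) mod 3" "j \<noteq> (j + 1) mod 3" unfolding j using i by presburger+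
    have arc: "fst u = i \<and> fst v = j \<and> A i (snd u) (snd v) \<or> fst u = j \<and> fst v = i \<and> A i (snd v) (snd u)"
      if "u \<in> part i \<union> part j" "v \<in> part i \<union> part j" "(u, v) \<in> parcs G" for u v
    proof -
      have uv: "fst u = i \<or> fst u = j" "fst v = i \<or> fst v = j"
        using that(1,2) by (auto simp: part_def)
      have "(u, v) \<in> E \<or> (v, u) \<in> E" using that(3) by (auto simp: G_def)
      then show ?thesis using E_fst[of u v] E_fst[of v u] uv ij j by metis
    qed
    assume "has_four_cycle (with_proj G \<restriction> (part i \<union> part j))"
    then obtain a b c d where m: "a \<in> part i \<union> part j" "b \<in> part i \<union> part j" "c \<in> part i \<union> part j" "d \<in> part i \<union> part j"
      and dist: "distinct [a, b, c, d]"
      and e: "(a, b) \<in> parcs G" "(b, c) \<in> parcs G" "(c, d) \<in> parcs G" "(d, a) \<in> parcs G"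
      unfolding has_four_cycle_iff[OF pg] by blast
    have V4: "snd a \<in> V" "snd b \<in> V" "snd c \<in> V" "snd d \<in> V" using m by (auto simp: part_def)
    note arcs = arc[OF m(1,2) e(1)] arc[OF m(2,3) e(2)] arc[OF m(3,4) e(3)] arc[OF m(4,1) e(4)]
    \<comment> \<open>The parts alternate along the cycle, so \<open>a\<close>, \<open>c\<close> lie
      on one side and \<open>b\<close>, \<open>d\<close> on the other; rectangle-freeness then
      identifies two opposite vertices.\<close>
    have "fst a = fst c \<and> fst b = fst d \<and> (snd a = snd c \<or> snd b = snd d)"
    proof (cases "fst a = i")
      case True
      then have *: "fst b = j" "fst c = i" "fst d = j" "A i (snd a) (snd b)" "A i (snd a) (snd d)"
        "A i (snd c) (snd b)" "A i (snd c) (snd d)" using arcs ij(1) by auto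
      show ?thesis
        using True * rectangle_freeD[OF free[OF i] V4(1,3,2,4) *(4-7)] by simp
    next
      case False
      then have *: "fst a = j" "fst b = i" "fst c = j" "fst d = i" "A i (snd b) (snd a)" "A i (snd b) (snd c)"
        "A i (snd d) (snd a)" "A i (snd d) (snd c)" using arcs ij(1) by auto
      show ?thesis
        using * rectangle_freeD[OF free[OF i] V4(2,4,1,3) *(5-8)] by auto
    qed
    then show False using dist by (auto simp: prod_eq_iff)
  qed
  have ind: "is_independent G (part i)" for i
    unfolding is_independent_def
  proof (intro ballI notI)
    fix u v assume "u \<in> part i" "v \<in> part i" "(u, v) \<in> parcs G"
    then show False using E_neq[of u v] E_neq[of v u] by (auto simp: part_def G_def)
  qed
  have "{..<3} = {0, 1, 2 :: nat}" by auto
  then have "part 0 \<union> part 1 \<union> part 2 = pverts G" by (auto simp: G_def part_def)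
  moreover have "part i \<inter> part j = {}" if "i \<noteq> j" for i j using that by (auto simp: part_def)
  moreover have "card (part i) = card V" for i by (simp add: part_def card_cartesian_product)
  ultimately have "tripartition (card V) G (part 0) (part 1) (part 2)"
    unfolding tripartition_def using ind by simp
  \<comment> \<open>The cyclic convention directs the last pair from part 2 to part 0.\<close>
  moreover have "part 0 \<union> part 2 = part 2 \<union> part 0" by blast
  ultimately have adm: "admissible (card V) G"
    unfolding admissible_def using pg no_c4[of 0 1] no_c4[of 1 2] no_c4[of 2 0]
    by (intro conjI exI[of _ "part 0"] exI[of _ "part 1"] exI[of _ "part 2"]) simp_all
  let ?T = "{(x, y, z). x \<in> V \<and> y \<in> V \<and> z \<in> V \<and> A 0 x y \<and> A 1 y z \<and> A 2 z x}"
  let ?tri = "\<lambda>(x, y, z). {(0::nat, x), (1, y), (2, z)}"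
  have "card ?T = card (?tri ` ?T)"
  proof (rule card_image[symmetric], rule inj_onI)
    have "(x, y, z) = (x', y', z')" if "?tri (x, y, z) = ?tri (x', y', z')" for x y z x' y' z'
    proof -
      have "(i, w) \<in> ?tri (x, y, z) \<longleftrightarrow> (i, w) \<in> ?tri (x', y', z')" for i w
        unfolding that ..
      from this[of 0 x] this[of 1 y] this[of 2 z] show ?thesis by simp
    qed
    then show "u = v" if "?tri u = ?tri v" for u v using that by (metis prod_cases3)
  qed
  also have "\<dots> \<le> card (triangles G)"
  proof (rule card_mono)
    show "finite (triangles G)"
      by (rule finite_subset[of _ "Pow (pverts G)"]) (use V in \<open>auto simp: triangles_def G_def\<close>)
    show "?tri ` ?T \<subseteq> triangles G"
    proof (rule image_subsetI)
      fix t assume "t \<in> ?T"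
      then obtain x y z where t: "t = (x, y, z)" and "x \<in> V" "y \<in> V" "z \<in> V"
        "A 0 x y" "A 1 y z" "A 2 z x" by blast
      then have "((0, x), (1, y)) \<in> E" "((1, y), (2, z)) \<in> E" "((2, z), (0, x)) \<in> E"
        "?tri t \<subseteq> {..<3} \<times> V" by (auto simp: E_def)
      then show "?tri t \<in> triangles G"
        unfolding triangles_iff[OF pg] by (auto simp: G_def t)
    qed
  qed
  also have "\<dots> \<le> \<triangle>(card V)"
    by (rule card_triangles_le_max_triangles[OF adm])
  finally show ?thesis .
qed

section \<open>Planar functions\<close>

lemma (in abelian_group) minus_left_cancel:
  assumes "a \<ominus> b = a \<ominus> c" "a \<in> carrier G" "b \<in> carrier G" "c \<in> carrier G"
  shows "b = c"
proof -
  have "a \<ominus> (a \<ominus> x) = x" if "x \<in> carrier G" for x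
    using that assms(2) by (simp add: minus_eq minus_add r_neg a_assoc[symmetric])
  then show ?thesis using assms by metis
qed

text \<open>On a finite carrier, injectivity of the difference maps is the bijectivity in the usual
  notion of a planar function.\<close>

definition (in ring) planar :: "('a \<Rightarrow> 'a) \<Rightarrow> bool" where
  "planar f \<longleftrightarrow> f \<in> carrier R \<rightarrow> carrier R \<and>
     (\<forall>a\<in>carrier R - {\<zero>}. inj_on (\<lambda>x. f (x \<oplus> a) \<ominus> f x) (carrier R))"

text \<open>For any common neighbour \<open>y\<close> of \<open>x\<close> and \<open>x'\<close>, the
  difference of \<open>f\<close> at \<open>x1 - y1\<close> and \<open>x1' - y1\<close> equals
  \<open>x2 - x2'\<close>, independently of \<open>y\<close>. If \<open>x1 \<noteq> x1'\<close>,
  planarity determines \<open>y1\<close> and adjacency then determines \<open>y2\<close>. If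
  \<open>x1 = x1'\<close>, a single neighbour forces \<open>x2 = x2'\<close>.\<close>

lemma (in ring) planar_rectangle_free:
  assumes "planar f"
  shows "rectangle_free (carrier R \<times> carrier R) (\<lambda>x y. snd x \<ominus> snd y = f (fst x \<ominus> fst y))"
  unfolding rectangle_free_def
proof (intro ballI impI)
  fix x x' y y' :: "'a \<times> 'a"
  assume xy: "x \<in> carrier R \<times> carrier R" "x' \<in> carrier R \<times> carrier R"
    "y \<in> carrier R \<times> carrier R" "y' \<in> carrier R \<times> carrier R"
  and e: "snd x \<ominus> snd y = f (fst x \<ominus> fst y) \<and> snd x \<ominus> snd y' = f (fst x \<ominus> fst y') \<and>
    snd x' \<ominus> snd y = f (fst x' \<ominus> fst y) \<and> snd x' \<ominus> snd y' = f (fst x' \<ominus> fst y')"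
  obtain x1 x2 x1' x2' y1 y2 y1' y2' where
    [simp]: "x = (x1, x2)" "x' = (x1', x2')" "y = (y1, y2)" "y' = (y1', y2')"
    by (meson surj_pair)
  have c [simp]: "x1 \<in> carrier R" "x2 \<in> carrier R" "x1' \<in> carrier R" "x2' \<in> carrier R"
    "y1 \<in> carrier R" "y2 \<in> carrier R" "y1' \<in> carrier R" "y2' \<in> carrier R"
    using xy by auto
  have e': "x2 \<ominus> y2 = f (x1 \<ominus> y1)" "x2 \<ominus> y2' = f (x1 \<ominus> y1')"
     "x2' \<ominus> y2 = f (x1' \<ominus> y1)" "x2' \<ominus> y2' = f (x1' \<ominus> y1')" using e by auto
  show "x = x' \<or> y = y'"
  proof (cases "x1 = x1'")
    case True
    then have "x2 \<ominus> y2 = x2' \<ominus> y2" using e' by simp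
    then show ?thesis using True by (simp add: minus_eq)
  next
    case False
    let ?a = "x1 \<ominus> x1'"
    have a: "?a \<in> carrier R - {\<zero>}" using False by (simp add: r_right_minus_eq)
    have sh: "x1' \<ominus> v \<oplus> ?a = x1 \<ominus> v" if "v \<in> carrier R" for v
      using that c by algebra
    have d: "x2 \<ominus> v \<ominus> (x2' \<ominus> v) = x2 \<ominus> x2'" if "v \<in> carrier R" for v
      using that c by algebra
    have "f (x1' \<ominus> y1 \<oplus> ?a) \<ominus> f (x1' \<ominus> y1) = f (x1' \<ominus> y1' \<oplus> ?a) \<ominus> f (x1' \<ominus> y1')"
      unfolding sh[OF c(5)] sh[OF c(7)] e'[symmetric] by (simp add: d)
    moreover have "inj_on (\<lambda>x. f (x \<oplus> ?a) \<ominus> f x) (carrier R)"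
      using assms a unfolding planar_def by blast
    ultimately have "x1' \<ominus> y1 = x1' \<ominus> y1'"
      by (auto dest: inj_onD)
    then have y1: "y1 = y1'"
      using c by (meson minus_left_cancel)
    then have "x2 \<ominus> y2 = x2 \<ominus> y2'" using e' by simp
    then have "y2 = y2'"
      using c by (meson minus_left_cancel)
    then show ?thesis using y1 by simp
  qed
qed

text \<open>Around a triangle the differences in each coordinate sum to zero. With first-coordinate
  differences \<open>a\<close>, \<open>b\<close> and \<open>- (a + b)\<close>, the second
  coordinates close up exactly when \<open>(a, b)\<close> is in \<open>S\<close>. So every vertex of
  part 0 lies in a triangle for each element of \<open>S\<close>.\<close>

lemma (in ring) max_triangles_ge_planar:
  assumes fin: "finite (carrier R)" and pl: "planar f" "planar g" "planar h"
  defines "S \<equiv> {(a, b). a \<in> carrier R \<and> b \<in> carrier R \<and> f a \<oplus> g b \<oplus> h (\<ominus> (a \<oplus> b)) = \<zero>}"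
  shows "card (carrier R) ^ 2 * card S \<le> \<triangle>(card (carrier R) ^ 2)"
proof -
  define V where "V = carrier R \<times> carrier R"
  define rel where "rel = (\<lambda>f x y. snd x \<ominus> snd y = f (fst x \<ominus> fst y))"
  define A where "A = (\<lambda>i::nat. rel (if i = 0 then f else if i = 1 then g else h))"
  have V: "finite V" "card V = card (carrier R) ^ 2"
    using fin by (simp_all add: V_def card_cartesian_product power2_eq_square)
  have free: "rectangle_free V (A i)" for i
    using planar_rectangle_free pl by (simp add: A_def rel_def V_def)
  have [simp]: "f x \<in> carrier R" "g x \<in> carrier R" "h x \<in> carrier R" if "x \<in> carrier R" for x
    using pl that by (auto simp: planar_def)
  let ?t = "\<lambda>((x1, x2), (a, b)). ((x1, x2), (x1 \<ominus> a, x2 \<ominus> f a), (x1 \<ominus> (a \<oplus> b), x2 \<ominus> (f a \<oplus> g b)))"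
  let ?T = "{(x, y, z). x \<in> V \<and> y \<in> V \<and> z \<in> V \<and> A 0 x y \<and> A 1 y z \<and> A 2 z x}"
  have sub: "u \<ominus> (u \<ominus> v) = v" "u \<ominus> v \<ominus> u = \<ominus> v"
    if "u \<in> carrier R" "v \<in> carrier R" for u v
    using that by algebra+
  have sub': "u \<ominus> v \<ominus> (u \<ominus> (v \<oplus> w)) = w"
    if "u \<in> carrier R" "v \<in> carrier R" "w \<in> carrier R" for u v w
    using that by algebra
  have h: "h (\<ominus> (a \<oplus> b)) = \<ominus> (f a \<oplus> g b)" if "(a, b) \<in> S" for a b
    using that unfolding S_def by (intro minus_equality[symmetric]) (auto simp: a_comm)
  have "card (V \<times> S) = card (?t ` (V \<times> S))"
  proof (rule card_image[symmetric], rule inj_onI)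
    fix u v assume uv: "u \<in> V \<times> S" "v \<in> V \<times> S" "?t u = ?t v"
    obtain x1 x2 a b x1' x2' a' b' where u: "u = ((x1, x2), (a, b))" and v: "v = ((x1', x2'), (a', b'))"
      by (metis surj_pair)
    have c: "x1 \<in> carrier R" "a \<in> carrier R" "b \<in> carrier R" "a' \<in> carrier R" "b' \<in> carrier R"
      using uv u v by (auto simp: V_def S_def)
    have "x1 = x1'" "x2 = x2'" "x1 \<ominus> a = x1 \<ominus> a'" "x1 \<ominus> (a \<oplus> b) = x1 \<ominus> (a' \<oplus> b')"
      using uv(3) unfolding u v by auto
    moreover from this have "a = a'" "a \<oplus> b = a' \<oplus> b'"
      using c by (meson minus_left_cancel add.m_closed)+
    ultimately show "u = v" using c unfolding u v by simp
  qed
  also have "\<dots> \<le> card ?T"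
  proof (rule card_mono)
    show "finite ?T" by (rule finite_subset[of _ "V \<times> V \<times> V"]) (use V in auto)
    show "?t ` (V \<times> S) \<subseteq> ?T"
    proof (rule image_subsetI)
      fix u assume "u \<in> V \<times> S"
      then obtain x1 x2 a b where u: "u = ((x1, x2), (a, b))" and ab: "(a, b) \<in> S"
        and [simp]: "x1 \<in> carrier R" "x2 \<in> carrier R" by (auto simp: V_def)
      then have [simp]: "a \<in> carrier R" "b \<in> carrier R" by (auto simp: S_def)
      show "?t u \<in> ?T"
        unfolding u V_def A_def rel_def by (simp add: sub sub' h[OF ab])
    qed
  qed
  also have "\<dots> \<le> \<triangle>(card V)"
    using card_cyclic_triples_le_max_triangles[OF V(1) free] .
  finally show ?thesis by (simp add: card_cartesian_product V(2))
qed

section \<open>Cubic extensions with cyclic Galois group\<close>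

text \<open>The identity is still allowed as \<open>s\<close>; \<open>cubic_generator\<close>
  excludes it by an element that \<open>s\<close> moves.\<close>

locale cubic_cyclic_field = field R + s: ring_hom_cring R R s
  for R (structure) and s +
  assumes s_cube [simp]: "x \<in> carrier R \<Longrightarrow> s (s (s x)) = x"
    and char_neq_2: "\<one> \<oplus> \<one> \<noteq> \<zero>"
begin

lemma s_eq_iff:
  assumes "x \<in> carrier R" "y \<in> carrier R"
  shows "s x = s y \<longleftrightarrow> x = y"
  using assms s_cube by metis

lemma s_eq_zero_iff [simp]: "x \<in> carrier R \<Longrightarrow> s x = \<zero> \<longleftrightarrow> x = \<zero>"
  using s_eq_iff[of x \<zero>] by simp

lemma double_eq_zero_iff:
  assumes "x \<in> carrier R"
  shows "x \<oplus> x = \<zero> \<longleftrightarrow> x = \<zero>"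
proof -
  have "x \<oplus> x = (\<one> \<oplus> \<one>) \<otimes> x" using assms by algebra
  then show ?thesis using assms char_neq_2 integral_iff by simp
qed

lemma planar_norm_form:
  assumes c [simp]: "c \<in> carrier R" and c0: "c \<noteq> \<zero>"
  shows "planar (\<lambda>x. c \<otimes> (x \<otimes> s x))"
  unfolding planar_def
proof (intro conjI ballI inj_onI)
  fix a x y
  assume a0: "a \<in> carrier R - {\<zero>}" and x [simp]: "x \<in> carrier R" and y [simp]: "y \<in> carrier R"
    and eq: "c \<otimes> ((x \<oplus> a) \<otimes> s (x \<oplus> a)) \<ominus> c \<otimes> (x \<otimes> s x) =
      c \<otimes> ((y \<oplus> a) \<otimes> s (y \<oplus> a)) \<ominus> c \<otimes> (y \<otimes> s y)"
  then have a [simp]: "a \<in> carrier R" by simp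
  define d where "d = x \<ominus> y"
  have d [simp]: "d \<in> carrier R" by (simp add: d_def)
  have sd: "s d = s x \<ominus> s y" by (simp add: d_def minus_eq)
  \<comment> \<open>The second difference of the quadratic-like map \<open>x * s x\<close> is its
    polarization, which is additive in \<open>d\<close>.\<close>
  have "c \<otimes> (d \<otimes> s a \<oplus> a \<otimes> s d) =
    (c \<otimes> ((x \<oplus> a) \<otimes> (s x \<oplus> s a)) \<ominus> c \<otimes> (x \<otimes> s x)) \<ominus> (c \<otimes> ((y \<oplus> a) \<otimes> (s y \<oplus> s a)) \<ominus> c \<otimes> (y \<otimes> s y))"
    unfolding sd unfolding d_def using c x y a s.hom_closed[OF a] s.hom_closed[OF x] s.hom_closed[OF y]
    by algebra
  also have "\<dots> = \<zero>" using eq by (simp add: r_right_minus_eq)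
  finally have e1: "d \<otimes> s a \<oplus> a \<otimes> s d = \<zero>" using c0 integral_iff by simp
  have e2: "s d \<otimes> s (s a) \<oplus> s a \<otimes> s (s d) = \<zero>"
    using arg_cong[OF e1, of s] by simp
  have e3: "s (s d) \<otimes> a \<oplus> s (s a) \<otimes> d = \<zero>"
    using arg_cong[OF e2, of s] by simp
  \<comment> \<open>\<open>m\<close> is the product of the norms of \<open>d\<close> and
    \<open>a\<close>. Multiplying the three conjugate equations \<open>e1\<close>,
    \<open>e2\<close>, \<open>e3\<close> changes the sign three times, giving
    \<open>m = - m\<close>.\<close>
  define m where "m = d \<otimes> s d \<otimes> s (s d) \<otimes> (a \<otimes> s a \<otimes> s (s a))"
  have m [simp]: "m \<in> carrier R" by (simp add: m_def)
  have "m = (d \<otimes> s a) \<otimes> (s d \<otimes> s (s a)) \<otimes> (s (s d) \<otimes> a)"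
    unfolding m_def using a d s.hom_closed[OF a] s.hom_closed[OF d]
     s.hom_closed[OF s.hom_closed[OF a]] s.hom_closed[OF s.hom_closed[OF d]] by algebra
  also have "d \<otimes> s a = \<ominus> (a \<otimes> s d)" using e1 by (intro minus_equality[symmetric]) auto
  also have "s d \<otimes> s (s a) = \<ominus> (s a \<otimes> s (s d))" using e2 by (intro minus_equality[symmetric]) auto
  also have "s (s d) \<otimes> a = \<ominus> (s (s a) \<otimes> d)" using e3 by (intro minus_equality[symmetric]) auto
  also have "\<ominus> (a \<otimes> s d) \<otimes> \<ominus> (s a \<otimes> s (s d)) \<otimes> \<ominus> (s (s a) \<otimes> d) = \<ominus> m"
    unfolding m_def using a d s.hom_closed[OF a] s.hom_closed[OF d]
     s.hom_closed[OF s.hom_closed[OF a]] s.hom_closed[OF s.hom_closed[OF d]] by algebra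
  finally have "m = \<ominus> m" .
  then have "m \<oplus> m = \<zero>" by (metis m r_neg)
  then have "m = \<zero>" by (simp add: double_eq_zero_iff)
  then have "d = \<zero>" using a0 by (simp add: m_def integral_iff)
  then show "x = y" by (simp add: d_def r_right_minus_eq)
qed simp

end

section \<open>Coefficients built from a moved element, and the zeros of the resulting form\<close>

locale cubic_generator = cubic_cyclic_field +
  fixes \<theta>
  assumes theta [simp]: "\<theta> \<in> carrier R" and theta_moved: "s \<theta> \<noteq> \<theta>"
begin

abbreviation "\<theta>' \<equiv> s \<theta>"
abbreviation "\<theta>'' \<equiv> s (s \<theta>)"

lemma theta_distinct: "\<theta>' \<noteq> \<theta>" "\<theta>'' \<noteq> \<theta>" "\<theta>'' \<noteq> \<theta>'"
  using theta_moved s_cube[OF theta] s_eq_iff by (metis s.hom_closed theta)+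

text \<open>As \<alpha> + \<gamma> = 1, the expression \<alpha> t s(t) + \<beta> + \<gamma> (t +
  1)(s(t) + 1) equals (t + \<gamma>)(s(t) + \<gamma>) - (\<gamma>^2 - \<gamma> - \<beta>). The value
  of \<beta> is the one that turns the last bracket into (\<theta>'' - \<theta>)(\<theta>'' -
  \<theta>').\<close>

definition "\<alpha> = \<one> \<ominus> \<theta>''"
definition "\<beta> = \<theta>'' \<otimes> (\<theta> \<oplus> \<theta>' \<ominus> \<one>) \<ominus> \<theta> \<otimes> \<theta>'"
definition "\<gamma> = \<theta>''"

lemma coeff_closed [simp]: "\<alpha> \<in> carrier R" "\<beta> \<in> carrier R" "\<gamma> \<in> carrier R"
  by (simp_all add: \<alpha>_def \<beta>_def \<gamma>_def)

lemma alpha_nonzero: "\<alpha> \<noteq> \<zero>"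
proof
  assume "\<alpha> = \<zero>"
  then have "\<theta>'' = \<one>" by (simp add: \<alpha>_def r_right_minus_eq)
  then show False using theta_distinct s.hom_one s_cube[OF theta] by metis
qed

lemma gamma_nonzero: "\<gamma> \<noteq> \<zero>"
  using theta_distinct unfolding \<gamma>_def by auto

text \<open>Put u = (\<theta> - 1) / \<theta>. If \<beta> = 0, then u s(u) = s(s(u)), and applying
  \<open>s\<close> gives s(u) s(s(u)) = u. Multiplying the two yields s(u)^2 = 1, hence 2 \<theta>'
  = 1. Then 2 \<theta>'' = 1 too, so \<theta>' = \<theta>'' in odd characteristic, a contradiction.
  The proof clears the denominators.\<close>

lemma beta_nonzero: "\<beta> \<noteq> \<zero>"
proof
  assume b: "\<beta> = \<zero>"
  define A where "A = \<theta> \<ominus> \<one>"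
  have A [simp]: "A \<in> carrier R" by (simp add: A_def)
  have sA: "s A = \<theta>' \<ominus> \<one>" "s (s A) = \<theta>'' \<ominus> \<one>" by (simp_all add: A_def minus_eq)
  have nz: "A \<noteq> \<zero>" "\<theta> \<noteq> \<zero>"
    using theta_distinct s.hom_one by (auto simp: A_def r_right_minus_eq)
  note cl = theta s.hom_closed[OF theta] s.hom_closed[OF s.hom_closed[OF theta]]
     A s.hom_closed[OF A] s.hom_closed[OF s.hom_closed[OF A]]
  have "A \<otimes> s A \<otimes> \<theta>'' \<ominus> \<theta> \<otimes> \<theta>' \<otimes> s (s A) = \<ominus> \<beta>"
    unfolding sA(2) unfolding sA(1) unfolding A_def \<beta>_def using cl(1-3) by algebra
  then have e1: "A \<otimes> s A \<otimes> \<theta>'' = \<theta> \<otimes> \<theta>' \<otimes> s (s A)"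
    using b by (simp add: r_right_minus_eq)
  have e2: "s A \<otimes> s (s A) \<otimes> \<theta> = \<theta>' \<otimes> \<theta>'' \<otimes> A"
    using arg_cong[OF e1, of s] by simp
  let ?k = "A \<otimes> s (s A) \<otimes> (\<theta> \<otimes> \<theta>'')"
  have "?k \<otimes> (s A \<otimes> s A) = (A \<otimes> s A \<otimes> \<theta>'') \<otimes> (s A \<otimes> s (s A) \<otimes> \<theta>)"
    using cl by algebra
  also have "\<dots> = ?k \<otimes> (\<theta>' \<otimes> \<theta>')"
    unfolding e1 e2 using cl by algebra
  finally have "s A \<otimes> s A = \<theta>' \<otimes> \<theta>'"
    using nz m_lcancel[of ?k] by (simp add: integral_iff)
  then have "(\<theta>' \<ominus> \<one>) \<otimes> (\<theta>' \<ominus> \<one>) \<ominus> \<theta>' \<otimes> \<theta>' = \<zero>"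
    unfolding sA by (simp add: r_right_minus_eq)
  moreover have "(\<theta>' \<ominus> \<one>) \<otimes> (\<theta>' \<ominus> \<one>) \<ominus> \<theta>' \<otimes> \<theta>' = \<one> \<ominus> (\<theta>' \<oplus> \<theta>')"
    using cl(2) by algebra
  ultimately have e: "\<theta>' \<oplus> \<theta>' = \<one>" by (simp add: r_right_minus_eq)
  have "\<theta>'' \<oplus> \<theta>'' = \<one>" using arg_cong[OF e, of s] by simp
  moreover have "(\<theta>' \<ominus> \<theta>'') \<oplus> (\<theta>' \<ominus> \<theta>'') = (\<theta>' \<oplus> \<theta>') \<ominus> (\<theta>'' \<oplus> \<theta>'')"
    using cl(2,3) by algebra
  ultimately have "(\<theta>' \<ominus> \<theta>'') \<oplus> (\<theta>' \<ominus> \<theta>'') = \<zero>" using e by (simp add: r_right_minus_eq)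
  then show False using theta_distinct by (simp add: double_eq_zero_iff r_right_minus_eq)
qed

text \<open>
  Dividing the equation for \<open>zeros\<close> below by \<open>b * s b\<close> leaves a condition on \<open>t = a / b\<close>, which
  factors because \<open>\<alpha> + \<gamma> = 1\<close>. Its solutions are the values \<open>slope r\<close> with \<open>r\<close> fixed by \<open>s\<close>, together
  with \<open>slope \<infinity> = - \<theta>\<close>.
\<close>

definition "slopes = {t \<in> carrier R. (t \<oplus> \<theta>'') \<otimes> (s t \<oplus> \<theta>'') = (\<theta>'' \<ominus> \<theta>) \<otimes> (\<theta>'' \<ominus> \<theta>')}"

definition "slope r = (\<theta>'' \<ominus> \<theta>) \<otimes> ((\<theta>' \<ominus> r) \<otimes> inv (\<theta> \<ominus> r)) \<ominus> \<theta>''"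

lemma slope_denom_unit:
  assumes "r \<in> carrier R" "s r = r"
  shows "\<theta> \<ominus> r \<in> Units R"
  using assms theta_moved by (auto simp: field_Units r_right_minus_eq)

text \<open>The first factor is (\<theta>'' - \<theta>)(\<theta>' - r) / (\<theta> - r). The second
  simplifies to (\<theta>'' - \<theta>')(\<theta> - r) / (\<theta>' - r), so the fractions cancel in
  the product.\<close>

lemma slope_in_slopes:
  assumes r [simp]: "r \<in> carrier R" and sr: "s r = r"
  shows "slope r \<in> slopes"
proof -
  define i where "i = inv (\<theta> \<ominus> r)"
  have i [simp]: "i \<in> carrier R" using slope_denom_unit[OF r sr] by (simp add: i_def)
  have iv: "(\<theta> \<ominus> r) \<otimes> i = \<one>" unfolding i_def using slope_denom_unit[OF r sr] by (simp add: Units_r_inv)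
  have jw: "(\<theta>' \<ominus> r) \<otimes> s i = \<one>"
    using arg_cong[OF iv, of s] by (simp add: minus_eq sr)
  note cl = theta s.hom_closed[OF theta] s.hom_closed[OF s.hom_closed[OF theta]]
    i s.hom_closed[OF i] r
  have sl: "slope r = (\<theta>'' \<ominus> \<theta>) \<otimes> ((\<theta>' \<ominus> r) \<otimes> i) \<ominus> \<theta>''" by (simp add: slope_def i_def)
  have "slope r \<oplus> \<theta>'' = (\<theta>'' \<ominus> \<theta>) \<otimes> ((\<theta>' \<ominus> r) \<otimes> i)"
    unfolding sl using cl by algebra
  moreover have "s (slope r) \<oplus> \<theta>'' = (\<theta> \<ominus> \<theta>') \<otimes> ((\<theta>'' \<ominus> r) \<otimes> s i) \<ominus> \<theta> \<oplus> \<theta>''"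
    unfolding sl by (simp add: minus_eq sr)
  \<comment> \<open>Inserting 1 = (\<theta>' - r) s(i) brings \<theta>'' - \<theta> over the common
    denominator.\<close>
  moreover have "\<dots> = (\<theta> \<ominus> \<theta>') \<otimes> ((\<theta>'' \<ominus> r) \<otimes> s i) \<oplus> (\<theta>'' \<ominus> \<theta>) \<otimes> ((\<theta>' \<ominus> r) \<otimes> s i)"
    unfolding jw using cl by algebra
  moreover have "\<dots> = (\<theta>'' \<ominus> \<theta>') \<otimes> ((\<theta> \<ominus> r) \<otimes> s i)"
    using cl by algebra
  ultimately have "(slope r \<oplus> \<theta>'') \<otimes> (s (slope r) \<oplus> \<theta>'') =
     (\<theta>'' \<ominus> \<theta>) \<otimes> ((\<theta>' \<ominus> r) \<otimes> i) \<otimes> ((\<theta>'' \<ominus> \<theta>') \<otimes> ((\<theta> \<ominus> r) \<otimes> s i))"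
    by simp
  also have "\<dots> = (\<theta>'' \<ominus> \<theta>) \<otimes> (\<theta>'' \<ominus> \<theta>') \<otimes> (((\<theta> \<ominus> r) \<otimes> i) \<otimes> ((\<theta>' \<ominus> r) \<otimes> s i))"
    by (simp add: m_ac)
  finally show ?thesis unfolding slopes_def iv jw by (simp add: sl)
qed

text \<open>Up to an affine map, \<open>slope\<close> is the Moebius transformation (\<theta>' - r)
  / (\<theta> - r), whose determinant is \<theta> - \<theta>' up to sign.\<close>

lemma slope_inj: "inj_on slope {r \<in> carrier R. s r = r}"
proof (rule inj_onI, clarify)
  fix r r' assume r [simp]: "r \<in> carrier R" and sr: "s r = r"
    and r' [simp]: "r' \<in> carrier R" and sr': "s r' = r'" and eq: "slope r = slope r'"
  note d = slope_denom_unit[OF r sr] slope_denom_unit[OF r' sr']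
  let ?i = "inv (\<theta> \<ominus> r)" and ?i' = "inv (\<theta> \<ominus> r')"
  have i [simp]: "?i \<in> carrier R" "?i' \<in> carrier R" using d by simp_all
  have iv: "(\<theta> \<ominus> r) \<otimes> ?i = \<one>" "(\<theta> \<ominus> r') \<otimes> ?i' = \<one>" using d by (simp_all add: Units_r_inv)
  note cl = theta s.hom_closed[OF theta] i r r'
  have "(\<theta>'' \<ominus> \<theta>) \<otimes> ((\<theta>' \<ominus> r) \<otimes> ?i) = (\<theta>'' \<ominus> \<theta>) \<otimes> ((\<theta>' \<ominus> r') \<otimes> ?i')"
    using eq unfolding slope_def minus_eq[of _ "\<theta>''"] by (simp add: add.right_cancel)
  then have e: "(\<theta>' \<ominus> r) \<otimes> ?i = (\<theta>' \<ominus> r') \<otimes> ?i'"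
    using m_lcancel[of "\<theta>'' \<ominus> \<theta>"] theta_distinct by (simp add: r_right_minus_eq)
  have "(\<theta>' \<ominus> r) \<otimes> (\<theta> \<ominus> r') \<otimes> ((\<theta> \<ominus> r) \<otimes> ?i) = ((\<theta>' \<ominus> r) \<otimes> ?i) \<otimes> ((\<theta> \<ominus> r) \<otimes> (\<theta> \<ominus> r'))"
    by (simp add: m_ac)
  also have "\<dots> = (\<theta>' \<ominus> r') \<otimes> (\<theta> \<ominus> r) \<otimes> ((\<theta> \<ominus> r') \<otimes> ?i')"
    unfolding e by (simp add: m_ac)
  finally have e': "(\<theta>' \<ominus> r) \<otimes> (\<theta> \<ominus> r') = (\<theta>' \<ominus> r') \<otimes> (\<theta> \<ominus> r)" unfolding iv by simp
  have "(\<theta> \<ominus> \<theta>') \<otimes> (r \<ominus> r') = (\<theta>' \<ominus> r') \<otimes> (\<theta> \<ominus> r) \<ominus> (\<theta>' \<ominus> r) \<otimes> (\<theta> \<ominus> r')"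
    using cl by algebra
  also have "\<dots> = \<zero>" unfolding e' by (simp add: r_right_minus_eq)
  finally show "r = r'" using theta_distinct by (simp add: integral_iff r_right_minus_eq)
qed

lemma uminus_theta_in_slopes: "\<ominus> \<theta> \<in> slopes"
proof -
  have "s (\<ominus> \<theta>) = \<ominus> \<theta>'" by simp
  then show ?thesis unfolding slopes_def by (simp add: minus_eq a_comm)
qed

text \<open>The value -\<theta> would require (\<theta>' - r) / (\<theta> - r) = 1, which happens
  only at infinity.\<close>

lemma slope_neq_uminus_theta:
  assumes r [simp]: "r \<in> carrier R" and sr: "s r = r"
  shows "slope r \<noteq> \<ominus> \<theta>"
proof
  assume eq: "slope r = \<ominus> \<theta>"
  let ?i = "inv (\<theta> \<ominus> r)"
  have i [simp]: "?i \<in> carrier R" using slope_denom_unit[OF r sr] by simp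
  have iv: "(\<theta> \<ominus> r) \<otimes> ?i = \<one>" using slope_denom_unit[OF r sr] by (simp add: Units_r_inv)
  note cl = theta s.hom_closed[OF theta] s.hom_closed[OF s.hom_closed[OF theta]] i r
  have "(\<theta>'' \<ominus> \<theta>) \<otimes> ((\<theta>' \<ominus> r) \<otimes> ?i \<ominus> (\<theta> \<ominus> r) \<otimes> ?i) = slope r \<oplus> \<theta>"
    unfolding iv slope_def using cl by algebra
  also have "\<dots> = \<zero>" unfolding eq by (simp add: l_neg)
  also have "(\<theta>' \<ominus> r) \<otimes> ?i \<ominus> (\<theta> \<ominus> r) \<otimes> ?i = (\<theta>' \<ominus> \<theta>) \<otimes> ?i" using cl by algebra
  finally have "?i = \<zero>" using theta_distinct by (simp add: integral_iff r_right_minus_eq)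
  then show False using iv by simp
qed

lemma card_slopes:
  assumes "finite (carrier R)"
  shows "card {r \<in> carrier R. s r = r} + 1 \<le> card slopes"
proof -
  let ?F = "{r \<in> carrier R. s r = r}"
  have "card ?F + 1 = card (insert (\<ominus> \<theta>) (slope ` ?F))"
  proof -
    have "\<ominus> \<theta> \<notin> slope ` ?F" using slope_neq_uminus_theta by force
    moreover have "finite ?F" using assms by simp
    ultimately show ?thesis by (simp add: card_image[OF slope_inj])
  qed
  also have "\<dots> \<le> card slopes"
    using assms slope_in_slopes uminus_theta_in_slopes by (intro card_mono) (auto simp: slopes_def)
  finally show ?thesis .
qed

text \<open>The negations match the set \<open>S\<close> of \<open>max_triangles_ge_planar\<close>;
  they leave the value unchanged because \<open>x * s x\<close> is even.\<close>

definition "zeros = {(a, b). a \<in> carrier R \<and> b \<in> carrier R \<and>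
  \<alpha> \<otimes> (a \<otimes> s a) \<oplus> \<beta> \<otimes> (b \<otimes> s b) \<oplus> \<gamma> \<otimes> (\<ominus> (a \<oplus> b) \<otimes> s (\<ominus> (a \<oplus> b))) = \<zero>}"

lemma zeros_mult_slope:
  assumes t: "t \<in> slopes" and b [simp]: "b \<in> carrier R"
  shows "(t \<otimes> b, b) \<in> zeros"
proof -
  have t' [simp]: "t \<in> carrier R" using t by (simp add: slopes_def)
  note cl = theta s.hom_closed[OF theta] s.hom_closed[OF s.hom_closed[OF theta]]
    b s.hom_closed[OF b] t' s.hom_closed[OF t']
  have "\<alpha> \<otimes> (t \<otimes> b \<otimes> (s t \<otimes> s b)) \<oplus> \<beta> \<otimes> (b \<otimes> s b) \<oplus>
     \<gamma> \<otimes> (\<ominus> (t \<otimes> b \<oplus> b) \<otimes> \<ominus> (s t \<otimes> s b \<oplus> s b)) =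
     b \<otimes> s b \<otimes> ((t \<oplus> \<theta>'') \<otimes> (s t \<oplus> \<theta>'') \<ominus> (\<theta>'' \<ominus> \<theta>) \<otimes> (\<theta>'' \<ominus> \<theta>'))"
    unfolding \<alpha>_def \<beta>_def \<gamma>_def using cl by algebra
  also have "\<dots> = \<zero>" using t by (simp add: slopes_def minus_eq r_neg)
  finally show ?thesis unfolding zeros_def by simp
qed

text \<open>For \<open>b \<noteq> 0\<close> the slope is recovered from \<open>(t * b, b)\<close>,
  so distinct slopes and distinct nonzero \<open>b\<close> give distinct zeros.\<close>

lemma card_zeros:
  assumes fin: "finite (carrier R)"
  shows "(card {r \<in> carrier R. s r = r} + 1) * (card (carrier R) - 1) \<le> card zeros"
proof -
  let ?f = "\<lambda>(t, b). (t \<otimes> b, b)"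
  have "(card {r \<in> carrier R. s r = r} + 1) * (card (carrier R) - 1) \<le>
      card slopes * card (carrier R - {\<zero>})"
    using card_slopes[OF fin] fin by (intro mult_mono) (auto simp: card_Diff_singleton)
  also have "\<dots> = card (?f ` (slopes \<times> (carrier R - {\<zero>})))"
    unfolding card_cartesian_product[symmetric]
    by (intro card_image[symmetric] inj_onI) (auto simp: slopes_def m_rcancel)
  also have "\<dots> \<le> card zeros"
  proof (rule card_mono)
    show "finite zeros"
      by (rule finite_subset[of _ "carrier R \<times> carrier R"]) (auto simp: zeros_def fin)
    show "?f ` (slopes \<times> (carrier R - {\<zero>})) \<subseteq> zeros"
      using zeros_mult_slope by auto
  qed
  finally show ?thesis .
qed

end

section \<open>The bound for cubic extensions and its finite-field instance\<close>

lemma (in cubic_generator) max_triangles_ge: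
  assumes fin: "finite (carrier R)"
  shows "card (carrier R) ^ 2 * ((card {r \<in> carrier R. s r = r} + 1) * (card (carrier R) - 1))
    \<le> \<triangle>(card (carrier R) ^ 2)"
proof -
  have "card (carrier R) ^ 2 * ((card {r \<in> carrier R. s r = r} + 1) * (card (carrier R) - 1))
    \<le> card (carrier R) ^ 2 * card zeros"
    by (intro mult_left_mono card_zeros[OF fin]) simp
  also have "\<dots> \<le> \<triangle>(card (carrier R) ^ 2)"
    using max_triangles_ge_planar[OF fin planar_norm_form[OF coeff_closed(1) alpha_nonzero]
      planar_norm_form[OF coeff_closed(2) beta_nonzero] planar_norm_form[OF coeff_closed(3) gamma_nonzero]]
    unfolding zeros_def .
  finally show ?thesis .
qed

text \<open>With q = p^n, both fields are found inside one algebraically closed field, as the fixed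
  points of the powers q^3 and q. The same count of Frobenius fixed points gives both
  orders.\<close>

lemma exists_cubic_cyclic_field:
  fixes p n :: nat
  assumes p: "prime p" and odd: "odd p" and n: "n \<ge> 1"
  obtains K :: "((int list \<times> nat) multiset \<Rightarrow> int) ring" and s
  where "cubic_cyclic_field K s" "finite (carrier K)" "card (carrier K) = (p ^ n) ^ 3"
    "card {x \<in> carrier K. s x = x} = p ^ n"
proof -
  obtain L :: "((int list \<times> nat) multiset \<Rightarrow> int) ring"
    where L: "algebraically_closed L" and char: "[p] \<cdot>\<^bsub>L\<^esub> \<one>\<^bsub>L\<^esub> = \<zero>\<^bsub>L\<^esub>"
    using exists_algebraically_closed_field[OF p] .
  interpret algebraically_closed L by fact
  define q where "q = p ^ n"
  define s where "s = (\<lambda>x. x [^]\<^bsub>L\<^esub> q)"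
  define S where "S = {x \<in> carrier L. x [^]\<^bsub>L\<^esub> (p ^ (n * 3)) = x}"
  have q3: "p ^ (n * 3) = q ^ 3" by (simp add: q_def power_mult)
  have cardS: "card S = q ^ 3"
    unfolding S_def q3[symmetric] using n by (intro card_frobenius_fixed_points p char) simp
  have q_pos: "q > 0" using prime_gt_0_nat[OF p] by (simp add: q_def)
  have s_hom: "s \<in> ring_hom L L"
    unfolding s_def q_def using frobenius_pow_hom[OF p char] .
  interpret s: ring_hom_cring L L s using s_hom by unfold_locales
  have s_cube: "s (s (s x)) = x" if "x \<in> S" for x
    using that by (simp add: S_def s_def q3 nat_pow_pow power3_eq_cube mult.assoc)
  have subf: "subfield S L"
    unfolding S_def by (rule fixed_points_subfield[OF frobenius_pow_hom[OF p char]])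
  let ?K = "L\<lparr>carrier := S\<rparr>"
  interpret K: field ?K by (rule subfield_iff(2)[OF subf])
  have S_sub: "S \<subseteq> carrier L" by (auto simp: S_def)
  have s_closed: "s x \<in> S" if "x \<in> S" for x
  proof -
    have x: "x \<in> carrier L" "x [^]\<^bsub>L\<^esub> (p ^ (n * 3)) = x" using that by (auto simp: S_def)
    have "(x [^]\<^bsub>L\<^esub> q) [^]\<^bsub>L\<^esub> (p ^ (n * 3)) = (x [^]\<^bsub>L\<^esub> (p ^ (n * 3))) [^]\<^bsub>L\<^esub> q"
      unfolding nat_pow_pow[OF x(1)] by (simp only: mult.commute)
    also have "\<dots> = x [^]\<^bsub>L\<^esub> q" unfolding x(2) ..
    finally show ?thesis unfolding S_def s_def using x(1) by blast
  qed
  have "s \<in> ring_hom ?K ?K"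
    using S_sub s_closed by (intro ring_hom_memI) (auto simp: subset_iff)
  then have sK: "ring_hom_cring ?K ?K s"
    by (intro ring_hom_cring.intro ring_hom_cring_axioms.intro K.is_cring)
  have "\<one>\<^bsub>L\<^esub> \<oplus>\<^bsub>L\<^esub> \<one>\<^bsub>L\<^esub> \<noteq> \<zero>\<^bsub>L\<^esub>"
  proof
    assume "\<one>\<^bsub>L\<^esub> \<oplus>\<^bsub>L\<^esub> \<one>\<^bsub>L\<^esub> = \<zero>\<^bsub>L\<^esub>"
    then have two: "[(2::nat)] \<cdot>\<^bsub>L\<^esub> \<one>\<^bsub>L\<^esub> = \<zero>\<^bsub>L\<^esub>" by (simp add: numeral_2_eq_2)
    obtain k where k: "p = Suc (2 * k)" using oddE[OF odd] by (metis Suc_eq_plus1)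
    have "[p] \<cdot>\<^bsub>L\<^esub> \<one>\<^bsub>L\<^esub> = \<one>\<^bsub>L\<^esub>"
      using add_pow_eq_zero_of_dvd[OF two, of "2 * k" "\<one>\<^bsub>L\<^esub>"]
      unfolding k by simp
    then show False using char by simp
  qed
  then have "cubic_cyclic_field ?K s"
    by (intro cubic_cyclic_field.intro cubic_cyclic_field_axioms.intro K.field_axioms sK)
      (simp_all add: s_cube)
  moreover have "card (carrier ?K) = q ^ 3" using cardS by simp
  moreover have "finite (carrier ?K)"
    using cardS q_pos by (intro card_ge_0_finite) simp
  \<comment> \<open>A point of \<open>L\<close> fixed by \<open>s\<close> is fixed by its cube, so
    it already lies in \<open>S\<close>.\<close>
  moreover have "{x \<in> carrier ?K. s x = x} = {x \<in> carrier L. x [^]\<^bsub>L\<^esub> (p ^ n) = x}"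
  proof -
    have "x [^]\<^bsub>L\<^esub> (p ^ (n * 3)) = x" if x: "x \<in> carrier L" "s x = x" for x
    proof -
      have "x [^]\<^bsub>L\<^esub> (p ^ (n * 3)) = s (s (s x))"
        using x(1) by (simp add: s_def q3 nat_pow_pow power3_eq_cube mult.assoc)
      then show ?thesis by (simp add: x(2))
    qed
    then show ?thesis unfolding S_def s_def q_def by auto
  qed
  then have "card {x \<in> carrier ?K. s x = x} = q"
    using card_frobenius_fixed_points[OF p char n] by (simp add: q_def)
  ultimately show ?thesis using that unfolding q_def by blast
qed

theorem theorem1p3:
  fixes p n q :: nat
  assumes "prime p" and "odd p" and "n \<ge> 1" and "q = p ^ n"
  shows "int (\<triangle>(q ^ 6)) \<ge> int q ^ 6 * (int q ^ 3 - 1) * (int q + 1)"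
proof -
  obtain K :: "((int list \<times> nat) multiset \<Rightarrow> int) ring" and s
    where "cubic_cyclic_field K s" and fin: "finite (carrier K)"
      and cK: "card (carrier K) = q ^ 3" and cF: "card {x \<in> carrier K. s x = x} = q"
    using exists_cubic_cyclic_field[OF assms(1-3)] unfolding assms(4) .
  then interpret cubic_cyclic_field K s by simp
  have q: "q > 1"
    unfolding assms(4) using prime_gt_1_nat[OF assms(1)] assms(3) by (intro one_less_power) auto
  \<comment> \<open>Comparing orders shows that \<open>s\<close> is not the identity on
    \<open>K\<close>, which supplies \<open>\<theta>\<close>.\<close>
  have "q < q ^ 3" using power_strict_increasing[of 1 3 q] q by simp
  then have "{x \<in> carrier K. s x = x} \<noteq> carrier K" using cK cF by (metis less_irrefl)
  then obtain \<theta> where "\<theta> \<in> carrier K" "s \<theta> \<noteq> \<theta>" by blast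
  then interpret cubic_generator K s \<theta> by unfold_locales
  have "(q ^ 3) ^ 2 * ((q + 1) * (q ^ 3 - 1)) \<le> \<triangle>((q ^ 3) ^ 2)"
    using max_triangles_ge[OF fin] unfolding cK cF .
  moreover have "(q ^ 3) ^ 2 = q ^ 6" by (simp flip: power_mult)
  ultimately have "int (q ^ 6 * ((q + 1) * (q ^ 3 - 1))) \<le> int (\<triangle>(q ^ 6))"
    by (simp only: of_nat_le_iff)
  moreover have "int (q ^ 3 - 1) = int q ^ 3 - 1" using q by (simp add: of_nat_diff)
  ultimately show ?thesis by (simp only: of_nat_mult of_nat_add of_nat_power of_nat_1 mult_ac)
qed

end
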